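(* Let $p$ be a prime and let $n\ge 1$ be an integer such that $m=(2np)^2-1$ is square-free. Then neither of the equations $x^2-my^2=p$ and $x^2-my^2=-p$ has a solution in integers $x,y$. *)

theory Defs
  imports
    "HOL-Computational_Algebra.Primes"
    "HOL-Computational_Algebra.Squarefree"
begin

end

theory Submission
  imports Defs
begin

text \<open>
  The element \<open>t + \<surd>(t\<^sup>2 - 1)\<close> with \<open>t = 2np\<close> is a unit of norm 1, so multiplication by its
  inverse maps solutions of \<open>x\<^sup>2 - (t\<^sup>2 - 1) y\<^sup>2 = N\<close> to solutions. When \<open>N\<close> is small compared
  with \<open>t\<close>, this strictly decreases \<open>\<bar>y\<bar>\<close>, provided that \<open>y \<noteq> 0\<close> and that the signs have been
  changed so that \<open>x\<close> and \<open>y\<close> are nonnegative. Fermat descent therefore ends at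
  \<open>y = 0\<close>, where the equation says that \<open>N\<close> is a perfect square (\<open>small_norm_is_square\<close>).
  Since \<open>t \<ge> 2p\<close>, the values \<open>N = p\<close> and \<open>N = - p\<close> are small in this sense; but a prime is not
  a square, and neither is a negative number.
\<close>

text \<open>
  For a solution with \<open>x \<ge> 0\<close> and \<open>y > 0\<close>, \<open>x\<close> is close to \<open>\<surd>(t\<^sup>2 - 1) y\<close>, hence close to \<open>t y\<close>;
  the size condition on \<open>N\<close> is what confines \<open>x\<close> strictly between \<open>(t - 1) y\<close> and \<open>(t + 1) y\<close>, so that the
  new second coordinate \<open>t y - x\<close> is smaller than \<open>y\<close> in absolute value.
\<close>

lemma small_norm_is_square:
  fixes t x y N :: int
  assumes "\<bar>N\<bar> < 2 * (t - 1)"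
    and "x\<^sup>2 - (t\<^sup>2 - 1) * y\<^sup>2 = N"
  shows "\<exists>z. N = z\<^sup>2"
  using assms(2)
proof (induction "nat \<bar>y\<bar>" arbitrary: x y rule: less_induct)
  case less
  show ?case
  proof (cases "y = 0")
    case True
    then show ?thesis
      using less.prems by auto
  next
    case False
    define a b where "a = \<bar>x\<bar>" and "b = \<bar>y\<bar>"
    have b: "b > 0" and a: "a \<ge> 0"
      using False by (auto simp: a_def b_def)
    have ab: "a\<^sup>2 - (t\<^sup>2 - 1) * b\<^sup>2 = N"
      using less.prems by (simp add: a_def b_def)
    have "b\<^sup>2 \<ge> 1"
      using b one_le_power[of b 2] by linarith
    then have "2 * (t - 1) * 1 \<le> 2 * (t - 1) * b\<^sup>2"
      using assms by (intro mult_left_mono) auto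
    then have N: "\<bar>N\<bar> < 2 * (t - 1) * b\<^sup>2"
      using assms(1) by linarith
    have "a\<^sup>2 < ((t + 1) * b)\<^sup>2"
    proof -
      have "((t + 1) * b)\<^sup>2 - a\<^sup>2 = 2 * (t - 1) * b\<^sup>2 + 4 * b\<^sup>2 - N"
        unfolding ab[symmetric] by (simp add: power2_eq_square algebra_simps)
      then show ?thesis
        using N \<open>b\<^sup>2 \<ge> 1\<close> by linarith
    qed
    then have up: "a < (t + 1) * b"
      using assms(1) b by (simp add: power2_less_imp_less)
    have "((t - 1) * b)\<^sup>2 < a\<^sup>2"
    proof -
      have "a\<^sup>2 - ((t - 1) * b)\<^sup>2 = 2 * (t - 1) * b\<^sup>2 + N"
        unfolding ab[symmetric] by (simp add: power2_eq_square algebra_simps)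
      then show ?thesis
        using N by linarith
    qed
    then have low: "(t - 1) * b < a"
      using a by (rule power2_less_imp_less)
    have "nat \<bar>t * b - a\<bar> < nat \<bar>y\<bar>"
      using up low b unfolding b_def[symmetric] by (simp add: algebra_simps)
    \<comment> \<open>the product of \<open>a + b \<surd>(t\<^sup>2 - 1)\<close> with the unit \<open>t - \<surd>(t\<^sup>2 - 1)\<close>, of the same norm\<close>
    moreover have "(t * a - (t\<^sup>2 - 1) * b)\<^sup>2 - (t\<^sup>2 - 1) * (t * b - a)\<^sup>2 = N"
      unfolding ab[symmetric] by (simp add: power2_eq_square algebra_simps)
    ultimately show ?thesis
      by (rule less.hyps)
  qed
qed

theorem theorem2p1:
  fixes p n m :: int
  assumes "prime p"
    and "n \<ge> 1"
    and "m = (2 * n * p)\<^sup>2 - 1"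
    and "squarefree m"
  shows "\<not> (\<exists>x y :: int. x\<^sup>2 - m * y\<^sup>2 = p) \<and>
         \<not> (\<exists>x y :: int. x\<^sup>2 - m * y\<^sup>2 = - p)"
proof -
  have p: "p \<ge> 2"
    using assms(1) by (rule prime_ge_2_int)
  define t where "t = 2 * n * p"
  have m: "m = t\<^sup>2 - 1"
    by (simp add: t_def assms(3))
  have "2 * p \<le> t"
    unfolding t_def using assms(2) p by (intro mult_right_mono) auto
  then have t: "p < 2 * (t - 1)"
    using p by simp
  have "x\<^sup>2 - m * y\<^sup>2 \<noteq> p" for x y
  proof
    assume "x\<^sup>2 - m * y\<^sup>2 = p"
    then obtain z where "p = z\<^sup>2"
      using small_norm_is_square[of p t x y] t p by (auto simp: m)
    then show False
      using assms(1) prime_power_iff[of z 2] by simp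
  qed
  moreover have "x\<^sup>2 - m * y\<^sup>2 \<noteq> - p" for x y
  proof
    assume "x\<^sup>2 - m * y\<^sup>2 = - p"
    then obtain z where "- p = z\<^sup>2"
      using small_norm_is_square[of "- p" t x y] t p by (auto simp: m)
    then show False
      using p zero_le_power2[of z] by linarith
  qed
  ultimately show ?thesis
    by blast
qed

end
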